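(* Let $\mathcal{S}$ be a simplicial category, let $X\in\mathcal{S}$ and let $K\in\mathbf{sSet}$. (1) Let $(X\otimes K,\alpha_{K,X},\{\phi_{K,X,Y}\}_{Y\in\mathcal{S}})$ and $(X\otimes' K,\alpha'_{K,X},\{\phi'_{K,X,Y}\}_{Y\in\mathcal{S}})$ be two $K$-cylinders of $X$. Then there exists a unique isomorphism $f:X\otimes K\to X\otimes' K$ of $\mathcal{S}$ such that $\alpha'_{K,X}=\underline{\mathcal{S}}(X,f)\circ\alpha_{K,X}$. In particular, $X\otimes K$ and $X\otimes' K$ are isomorphic. (2) Let $(X^K,\beta_{K,X},\{\psi_{K,Y,X}\}_{Y\in\mathcal{S}})$ and $((X^K)',\beta'_{K,X},\{\psi'_{K,Y,X}\}_{Y\in\mathcal{S}})$ be two $K$-paths of $X$. Then there exists a unique isomorphism $f:X^K\to (X^K)'$ of $\mathcal{S}$ such that $\beta_{K,X}=\underline{\mathcal{S}}(f,X)\circ\beta'_{K,X}$. In particular, $X^K$ and $(X^K)'$ are isomorphic.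
   Context: $\mathbf{sSet}$ is the category of simplicial sets, $\circ$ is ordinary composition in a category, and $\sigma^n_0:[n]\to[0]$ is the unique map in $\Delta$. Simplicial category: a category $\mathcal{S}$ equipped with: (S1) a functor $\underline{\mathcal{S}}(-,-):\mathcal{S}^{\mathrm{op}}\times\mathcal{S}\to\mathbf{sSet}$; (S2) for all $X,Y,Z\in\mathcal{S}$ a morphism of simplicial sets $\underline{\bullet}_{X,Y,Z}:\underline{\mathcal{S}}(X,Y)\times\underline{\mathcal{S}}(Y,Z)\to\underline{\mathcal{S}}(X,Z)$, written $(f,g)\mapsto g\,\underline{\bullet}_n f$ on $n$-simplices; (S3) a natural isomorphism $\widetilde{(\;)}:\mathcal{S}(-,-)\to\underline{\mathcal{S}}(-,-)_0$ of functors $\mathcal{S}^{\mathrm{op}}\times\mathcal{S}\to\mathbf{Set}$; such that (S4) $(h\,\underline{\bullet}_n g)\,\underline{\bullet}_n f=h\,\underline{\bullet}_n(g\,\underline{\bullet}_n f)$ for $f\in\underline{\mathcal{S}}(X,Y)_n$, $g\in\underline{\mathcal{S}}(Y,Z)_n$, $h\in\underline{\mathcal{S}}(Z,W)_n$; and (S5) $\underline{\mathcal{S}}(X,g)_n(f)=(\sigma^n_0)^*(\widetilde g)\,\underline{\bullet}_n f$ for $f\in\underline{\mathcal{S}}(X,Y)_n$, $g\in\mathcal{S}(Y,Z)$, and $\underline{\mathcal{S}}(f,Z)_n(g)=g\,\underline{\bullet}_n(\sigma^n_0)^*(\widetilde f)$ for $f\in\mathcal{S}(X,Y)$, $g\in\underline{\mathcal{S}}(Y,Z)_n$.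 Internal hom and evaluation: for $A,B\in\mathbf{sSet}$, $\underline{\mathbf{sSet}}(A,B)$ is the simplicial set with $\underline{\mathbf{sSet}}(A,B)_n=\mathbf{sSet}(A\times\Delta[n],B)$, where $\theta\in\Delta([m],[n])$ acts by precomposition with $\mathrm{id}_A\times\Delta[\theta]$. The map $\mathrm{ev}_{A,B}:A\times\underline{\mathbf{sSet}}(A,B)\to B$ is $(\mathrm{ev}_{A,B})_n(a,f)=f_n(a,\mathrm{id}_{[n]})$. $K$-cylinder of $X$: a triple $(X\otimes K,\alpha_{K,X},\{\phi_{K,X,Y}\}_{Y\in\mathcal{S}})$ consisting of an object $X\otimes K$ of $\mathcal{S}$, a morphism $\alpha_{K,X}:K\to\underline{\mathcal{S}}(X,X\otimes K)$ of $\mathbf{sSet}$, and, for every $Y\in\mathcal{S}$, an isomorphism $\phi_{K,X,Y}:\underline{\mathcal{S}}(X\otimes K,Y)\to\underline{\mathbf{sSet}}(K,\underline{\mathcal{S}}(X,Y))$ of $\mathbf{sSet}$ such that $\mathrm{ev}_{K,\underline{\mathcal{S}}(X,Y)}\circ(\mathrm{id}_K\times\phi_{K,X,Y})=\underline{\bullet}_{X,X\otimes K,Y}\circ(\alpha_{K,X}\times\mathrm{id}_{\underline{\mathcal{S}}(X\otimes K,Y)})$ as maps $K\times\underline{\mathcal{S}}(X\otimes K,Y)\to\underline{\mathcal{S}}(X,Y)$. $K$-path of $X$: a triple $(X^K,\beta_{K,X},\{\psi_{K,Y,X}\}_{Y\in\mathcal{S}})$ consisting of an object $X^K$ of $\mathcal{S}$,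 a morphism $\beta_{K,X}:K\to\underline{\mathcal{S}}(X^K,X)$ of $\mathbf{sSet}$, and, for every $Y\in\mathcal{S}$, an isomorphism $\psi_{K,Y,X}:\underline{\mathcal{S}}(Y,X^K)\to\underline{\mathbf{sSet}}(K,\underline{\mathcal{S}}(Y,X))$ of $\mathbf{sSet}$ such that $\mathrm{ev}_{K,\underline{\mathcal{S}}(Y,X)}\circ(\mathrm{id}_K\times\psi_{K,Y,X})=\underline{\bullet}_{Y,X^K,X}\circ(\mathrm{pr}_2,\beta_{K,X}\circ\mathrm{pr}_1)$ as maps $K\times\underline{\mathcal{S}}(Y,X^K)\to\underline{\mathcal{S}}(Y,X)$. *)

theory Defs
  imports "HOL-Library.FuncSet"
begin

section \<open>Categories and functors\<close>

text \<open>
  A category with object set \<open>Ob\<close> and arrow set \<open>Ar\<close>; every arrow carries its domain and codomain.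
  \<open>Comp C g f\<close> is the composite of \<open>f\<close> followed by \<open>g\<close>.
\<close>

record ('o, 'm) cat =
  Ob    :: "'o set"
  Ar    :: "'m set"
  Dom   :: "'m \<Rightarrow> 'o"
  Cod   :: "'m \<Rightarrow> 'o"
  Ident :: "'o \<Rightarrow> 'm"
  Comp  :: "'m \<Rightarrow> 'm \<Rightarrow> 'm"

definition hom :: "('o, 'm, 'z) cat_scheme \<Rightarrow> 'o \<Rightarrow> 'o \<Rightarrow> 'm set" where
  "hom C X Y = {f \<in> Ar C. Dom C f = X \<and> Cod C f = Y}"

locale category =
  fixes C :: "('o, 'm, 'z) cat_scheme"
  assumes dom_closed: "f \<in> Ar C \<Longrightarrow> Dom C f \<in> Ob C"
    and cod_closed: "f \<in> Ar C \<Longrightarrow> Cod C f \<in> Ob C"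
    and id_closed: "X \<in> Ob C \<Longrightarrow> Ident C X \<in> hom C X X"
    and comp_closed: "f \<in> hom C X Y \<Longrightarrow> g \<in> hom C Y Z \<Longrightarrow> Comp C g f \<in> hom C X Z"
    and id_left: "f \<in> hom C X Y \<Longrightarrow> Comp C (Ident C Y) f = f"
    and id_right: "f \<in> hom C X Y \<Longrightarrow> Comp C f (Ident C X) = f"
    and comp_assoc: "f \<in> hom C X Y \<Longrightarrow> g \<in> hom C Y Z \<Longrightarrow> h \<in> hom C Z W \<Longrightarrow>
          Comp C (Comp C h g) f = Comp C h (Comp C g f)"

definition isos :: "('o, 'm, 'z) cat_scheme \<Rightarrow> 'o \<Rightarrow> 'o \<Rightarrow> 'm set" where
  "isos C X Y = {f \<in> hom C X Y. \<exists>g\<in>hom C Y X. Comp C g f = Ident C X \<and> Comp C f g = Ident C Y}"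

definition isomorphic :: "('o, 'm, 'z) cat_scheme \<Rightarrow> 'o \<Rightarrow> 'o \<Rightarrow> bool" where
  "isomorphic C X Y \<longleftrightarrow> isos C X Y \<noteq> {}"

definition op_cat :: "('o, 'm, 'z) cat_scheme \<Rightarrow> ('o, 'm) cat" where
  "op_cat C = \<lparr>Ob = Ob C, Ar = Ar C, Dom = Cod C, Cod = Dom C, Ident = Ident C,
     Comp = (\<lambda>g f. Comp C f g)\<rparr>"

definition prod_cat ::
  "('o, 'm, 'z) cat_scheme \<Rightarrow> ('p, 'n, 'y) cat_scheme \<Rightarrow> ('o \<times> 'p, 'm \<times> 'n) cat" where
  "prod_cat C D = \<lparr>Ob = Ob C \<times> Ob D, Ar = Ar C \<times> Ar D,
     Dom = map_prod (Dom C) (Dom D), Cod = map_prod (Cod C) (Cod D),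
     Ident = map_prod (Ident C) (Ident D),
     Comp = (\<lambda>(g, g') (f, f'). (Comp C g f, Comp D g' f'))\<rparr>"

locale is_functor = source: category C + target: category D
  for C :: "('o, 'm, 'z) cat_scheme" and D :: "('p, 'n, 'y) cat_scheme" +
  fixes Fo :: "'o \<Rightarrow> 'p" and Fm :: "'m \<Rightarrow> 'n"
  assumes ob_closed: "X \<in> Ob C \<Longrightarrow> Fo X \<in> Ob D"
    and ar_closed: "f \<in> hom C X Y \<Longrightarrow> Fm f \<in> hom D (Fo X) (Fo Y)"
    and pres_id: "X \<in> Ob C \<Longrightarrow> Fm (Ident C X) = Ident D (Fo X)"
    and pres_comp: "f \<in> hom C X Y \<Longrightarrow> g \<in> hom C Y Z \<Longrightarrow>
          Fm (Comp C g f) = Comp D (Fm g) (Fm f)"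


section \<open>The simplex category\<close>

text \<open>
  The object \<open>[n] = {0,...,n}\<close> is represented by the number \<open>n\<close>.  The underlying function of an
  arrow is required to be \<open>undefined\<close> outside \<open>{..dsrc \<theta>}\<close>, so that arrows are equal iff they agree
  as maps \<open>[m] \<rightarrow> [n]\<close>.
\<close>

record dmap =
  dsrc :: nat
  dtrg :: nat
  dfun :: "nat \<Rightarrow> nat"

definition delta :: "(nat, dmap) cat" where
  "delta = \<lparr>Ob = UNIV,
     Ar = {\<theta>. dfun \<theta> \<in> {..dsrc \<theta>} \<rightarrow>\<^sub>E {..dtrg \<theta>} \<and> mono_on {..dsrc \<theta>} (dfun \<theta>)},
     Dom = dsrc, Cod = dtrg,
     Ident = (\<lambda>n. \<lparr>dsrc = n, dtrg = n, dfun = (\<lambda>i\<in>{..n}. i)\<rparr>),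
     Comp = (\<lambda>\<theta> \<eta>. \<lparr>dsrc = dsrc \<eta>, dtrg = dtrg \<theta>,
                dfun = (\<lambda>i\<in>{..dsrc \<eta>}. dfun \<theta> (dfun \<eta> i))\<rparr>)\<rparr>"

definition sigma :: "nat \<Rightarrow> dmap" where
  "sigma n = \<lparr>dsrc = n, dtrg = 0, dfun = (\<lambda>i\<in>{..n}. 0)\<rparr>"


section \<open>Simplicial sets\<close>

text \<open>
  \<open>simplices K n\<close> is the set \<open>K\<^sub>n\<close>, and for \<open>\<theta> : [m] \<rightarrow> [n]\<close> the function \<open>act K \<theta> : K\<^sub>n \<rightarrow> K\<^sub>m\<close> is
  the induced map \<open>\<theta>\<^sup>*\<close>.  Values outside the domains are fixed to \<open>undefined\<close>, so that equality
  of records is equality of simplicial sets; the same convention applies to their morphisms.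
\<close>

record 'a sset =
  simplices :: "nat \<Rightarrow> 'a set"
  act :: "dmap \<Rightarrow> 'a \<Rightarrow> 'a"

locale simplicial_set =
  fixes K :: "'a sset"
  assumes act_ext: "act K \<in> extensional (Ar delta)"
    and act_closed: "\<theta> \<in> hom delta m n \<Longrightarrow> act K \<theta> \<in> simplices K n \<rightarrow>\<^sub>E simplices K m"
    and act_id: "x \<in> simplices K n \<Longrightarrow> act K (Ident delta n) x = x"
    and act_comp: "\<eta> \<in> hom delta l m \<Longrightarrow> \<theta> \<in> hom delta m n \<Longrightarrow> x \<in> simplices K n \<Longrightarrow>
          act K (Comp delta \<theta> \<eta>) x = act K \<eta> (act K \<theta> x)"

record ('a, 'b) smap =
  src :: "'a sset"
  trg :: "'b sset"
  app :: "nat \<Rightarrow> 'a \<Rightarrow> 'b"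

definition smaps :: "'a sset \<Rightarrow> 'b sset \<Rightarrow> ('a, 'b) smap set" where
  "smaps A B = {f. src f = A \<and> trg f = B \<and> simplicial_set A \<and> simplicial_set B \<and>
     (\<forall>n. app f n \<in> simplices A n \<rightarrow>\<^sub>E simplices B n) \<and>
     (\<forall>m n. \<forall>\<theta>\<in>hom delta m n. \<forall>x\<in>simplices A n. app f m (act A \<theta> x) = act B \<theta> (app f n x))}"

definition smap_id :: "'a sset \<Rightarrow> ('a, 'a) smap" where
  "smap_id A = \<lparr>src = A, trg = A, app = (\<lambda>n. \<lambda>x\<in>simplices A n. x)\<rparr>"

definition smap_comp :: "('b, 'c) smap \<Rightarrow> ('a, 'b) smap \<Rightarrow> ('a, 'c) smap" where
  "smap_comp g f = \<lparr>src = src f, trg = trg g,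
     app = (\<lambda>n. \<lambda>x\<in>simplices (src f) n. app g n (app f n x))\<rparr>"

definition sisos :: "'a sset \<Rightarrow> 'b sset \<Rightarrow> ('a, 'b) smap set" where
  "sisos A B = {f \<in> smaps A B. \<exists>g\<in>smaps B A. smap_comp g f = smap_id A \<and> smap_comp f g = smap_id B}"

text \<open>The simplicial sets whose simplices are drawn from the type \<open>'s\<close>.\<close>

definition sSet :: "('s sset, ('s, 's) smap) cat" where
  "sSet = \<lparr>Ob = {A. simplicial_set A}, Ar = {f. f \<in> smaps (src f) (trg f)},
     Dom = src, Cod = trg, Ident = smap_id, Comp = smap_comp\<rparr>"

definition sprod :: "'a sset \<Rightarrow> 'b sset \<Rightarrow> ('a \<times> 'b) sset" where
  "sprod A B = \<lparr>simplices = (\<lambda>n. simplices A n \<times> simplices B n),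
     act = (\<lambda>\<theta>\<in>Ar delta. \<lambda>(x, y)\<in>simplices A (dtrg \<theta>) \<times> simplices B (dtrg \<theta>).
              (act A \<theta> x, act B \<theta> y))\<rparr>"

definition pr1 :: "'a sset \<Rightarrow> 'b sset \<Rightarrow> ('a \<times> 'b, 'a) smap" where
  "pr1 A B = \<lparr>src = sprod A B, trg = A, app = (\<lambda>n. \<lambda>p\<in>simplices (sprod A B) n. fst p)\<rparr>"

definition pr2 :: "'a sset \<Rightarrow> 'b sset \<Rightarrow> ('a \<times> 'b, 'b) smap" where
  "pr2 A B = \<lparr>src = sprod A B, trg = B, app = (\<lambda>n. \<lambda>p\<in>simplices (sprod A B) n. snd p)\<rparr>"

text \<open>The map \<open>(f, g) : A \<rightarrow> B \<times> C\<close> induced by \<open>f : A \<rightarrow> B\<close> and \<open>g : A \<rightarrow> C\<close>.\<close>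

definition spair :: "('a, 'b) smap \<Rightarrow> ('a, 'c) smap \<Rightarrow> ('a, 'b \<times> 'c) smap" where
  "spair f g = \<lparr>src = src f, trg = sprod (trg f) (trg g),
     app = (\<lambda>n. \<lambda>x\<in>simplices (src f) n. (app f n x, app g n x))\<rparr>"

definition sprod_map :: "('a, 'c) smap \<Rightarrow> ('b, 'd) smap \<Rightarrow> ('a \<times> 'b, 'c \<times> 'd) smap" where
  "sprod_map f g = \<lparr>src = sprod (src f) (src g), trg = sprod (trg f) (trg g),
     app = (\<lambda>n. \<lambda>(x, y)\<in>simplices (src f) n \<times> simplices (src g) n. (app f n x, app g n y))\<rparr>"

definition std_simplex :: "nat \<Rightarrow> dmap sset" where
  "std_simplex n = \<lparr>simplices = (\<lambda>k. hom delta k n),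
     act = (\<lambda>\<eta>\<in>Ar delta. \<lambda>\<theta>\<in>hom delta (dtrg \<eta>) n. Comp delta \<theta> \<eta>)\<rparr>"

definition std_map :: "dmap \<Rightarrow> (dmap, dmap) smap" where
  "std_map \<theta> = \<lparr>src = std_simplex (dsrc \<theta>), trg = std_simplex (dtrg \<theta>),
     app = (\<lambda>k. \<lambda>\<eta>\<in>hom delta k (dsrc \<theta>). Comp delta \<theta> \<eta>)\<rparr>"

definition ihom :: "'a sset \<Rightarrow> 'b sset \<Rightarrow> ('a \<times> dmap, 'b) smap sset" where
  "ihom A B = \<lparr>simplices = (\<lambda>n. smaps (sprod A (std_simplex n)) B),
     act = (\<lambda>\<theta>\<in>Ar delta. \<lambda>f\<in>smaps (sprod A (std_simplex (dtrg \<theta>))) B.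
              smap_comp f (sprod_map (smap_id A) (std_map \<theta>)))\<rparr>"

definition ev :: "'a sset \<Rightarrow> 'b sset \<Rightarrow> ('a \<times> ('a \<times> dmap, 'b) smap, 'b) smap" where
  "ev A B = \<lparr>src = sprod A (ihom A B), trg = B,
     app = (\<lambda>n. \<lambda>(a, f)\<in>simplices A n \<times> simplices (ihom A B) n. app f n (a, Ident delta n))\<rparr>"


section \<open>Simplicial categories\<close>

text \<open>
  \<open>shom S X Y\<close> is the simplicial mapping space.  For \<open>f : X' \<rightarrow> X\<close> and \<open>g : Y \<rightarrow> Y'\<close>,
  \<open>shom_map S f g\<close> is the induced map from \<open>shom S X Y\<close> to \<open>shom S X' Y'\<close>.
  \<open>vertex S f\<close> is the 0-simplex corresponding to the arrow \<open>f\<close>.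
\<close>

record ('o, 'm, 's) simp_cat = "('o, 'm) cat" +
  shom :: "'o \<Rightarrow> 'o \<Rightarrow> 's sset"
  shom_map :: "'m \<Rightarrow> 'm \<Rightarrow> ('s, 's) smap"
  bullet :: "'o \<Rightarrow> 'o \<Rightarrow> 'o \<Rightarrow> ('s \<times> 's, 's) smap"
  vertex :: "'m \<Rightarrow> 's"

text \<open>
  The composite of the \<open>n\<close>-simplices \<open>g\<close> of \<open>shom S Y Z\<close> and \<open>f\<close> of \<open>shom S X Y\<close>; note that
  \<open>bullet S X Y Z\<close> is defined on \<open>shom S X Y \<times> shom S Y Z\<close> and so takes \<open>f\<close> first.
\<close>

abbreviation bul :: "('o, 'm, 's, 'z) simp_cat_scheme \<Rightarrow> 'o \<Rightarrow> 'o \<Rightarrow> 'o \<Rightarrow> nat \<Rightarrow> 's \<Rightarrow> 's \<Rightarrow> 's" where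
  "bul S X Y Z n g f \<equiv> app (bullet S X Y Z) n (f, g)"

locale simplicial_category = category S
  for S :: "('o, 'm, 's, 'z) simp_cat_scheme" +
  assumes shom_functor:
      "is_functor (prod_cat (op_cat S) S) sSet (\<lambda>(X, Y). shom S X Y) (\<lambda>(f, g). shom_map S f g)"
    and bullet_closed:
      "X \<in> Ob S \<Longrightarrow> Y \<in> Ob S \<Longrightarrow> Z \<in> Ob S \<Longrightarrow>
        bullet S X Y Z \<in> smaps (sprod (shom S X Y) (shom S Y Z)) (shom S X Z)"
    and vertex_bij:
      "X \<in> Ob S \<Longrightarrow> Y \<in> Ob S \<Longrightarrow> bij_betw (vertex S) (hom S X Y) (simplices (shom S X Y) 0)"
    and vertex_natural:
      "f \<in> hom S X' X \<Longrightarrow> h \<in> hom S X Y \<Longrightarrow> g \<in> hom S Y Y' \<Longrightarrow>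
        vertex S (Comp S g (Comp S h f)) = app (shom_map S f g) 0 (vertex S h)"
    and bullet_assoc:
      "X \<in> Ob S \<Longrightarrow> Y \<in> Ob S \<Longrightarrow> Z \<in> Ob S \<Longrightarrow> W \<in> Ob S \<Longrightarrow>
        u \<in> simplices (shom S X Y) n \<Longrightarrow> v \<in> simplices (shom S Y Z) n \<Longrightarrow>
        w \<in> simplices (shom S Z W) n \<Longrightarrow>
        bul S X Y W n (bul S Y Z W n w v) u = bul S X Z W n w (bul S X Y Z n v u)"
    and shom_map_right:
      "X \<in> Ob S \<Longrightarrow> g \<in> hom S Y Z \<Longrightarrow> u \<in> simplices (shom S X Y) n \<Longrightarrow>
        app (shom_map S (Ident S X) g) n u =
          bul S X Y Z n (act (shom S Y Z) (sigma n) (vertex S g)) u"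
    and shom_map_left:
      "Z \<in> Ob S \<Longrightarrow> f \<in> hom S X Y \<Longrightarrow> v \<in> simplices (shom S Y Z) n \<Longrightarrow>
        app (shom_map S f (Ident S Z)) n v =
          bul S X Y Z n v (act (shom S X Y) (sigma n) (vertex S f))"

definition is_cylinder ::
  "('o, 'm, 's, 'z) simp_cat_scheme \<Rightarrow> 'k sset \<Rightarrow> 'o \<Rightarrow>
    'o \<Rightarrow> ('k, 's) smap \<Rightarrow> ('o \<Rightarrow> ('s, ('k \<times> dmap, 's) smap) smap) \<Rightarrow> bool" where
  "is_cylinder S K X XK \<alpha> \<phi> \<longleftrightarrow>
     XK \<in> Ob S \<and>
     \<alpha> \<in> smaps K (shom S X XK) \<and>
     (\<forall>Y\<in>Ob S. \<phi> Y \<in> sisos (shom S XK Y) (ihom K (shom S X Y)) \<and>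
        smap_comp (ev K (shom S X Y)) (sprod_map (smap_id K) (\<phi> Y)) =
        smap_comp (bullet S X XK Y) (sprod_map \<alpha> (smap_id (shom S XK Y))))"

definition is_path ::
  "('o, 'm, 's, 'z) simp_cat_scheme \<Rightarrow> 'k sset \<Rightarrow> 'o \<Rightarrow>
    'o \<Rightarrow> ('k, 's) smap \<Rightarrow> ('o \<Rightarrow> ('s, ('k \<times> dmap, 's) smap) smap) \<Rightarrow> bool" where
  "is_path S K X XK \<beta> \<psi> \<longleftrightarrow>
     XK \<in> Ob S \<and>
     \<beta> \<in> smaps K (shom S XK X) \<and>
     (\<forall>Y\<in>Ob S. \<psi> Y \<in> sisos (shom S Y XK) (ihom K (shom S Y X)) \<and>
        smap_comp (ev K (shom S Y X)) (sprod_map (smap_id K) (\<psi> Y)) =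
        smap_comp (bullet S Y XK X)
          (spair (pr2 K (shom S Y XK)) (smap_comp \<beta> (pr1 K (shom S Y XK)))))"

end

theory Submission imports Defs begin

text \<open>
  A \<open>K\<close>-cylinder \<open>(X \<otimes> K, \<alpha>)\<close> is initial among pairs of an object \<open>Y\<close> and a map
  \<open>\<gamma> : K \<rightarrow> S(X, Y)\<close>. Indeed \<open>\<phi>\<close> in degree \<open>0\<close> identifies arrows \<open>X \<otimes> K \<rightarrow> Y\<close>, which are the
  vertices of \<open>S(X \<otimes> K, Y)\<close>, with maps \<open>K \<times> \<Delta>[0] \<rightarrow> S(X, Y)\<close>, that is, with maps
  \<open>K \<rightarrow> S(X, Y)\<close>. Evaluating at \<open>(a, \<sigma>\<^sub>0\<^sup>n)\<close> and using naturality of \<open>\<phi>\<close> along \<open>\<sigma>\<^sub>0\<^sup>n\<close>, the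
  compatibility of \<open>\<phi>\<close> with \<open>\<alpha>\<close> and (S5), the arrow \<open>f\<close> corresponds to \<open>S(X, f) \<circ> \<alpha>\<close>. Uniqueness
  up to unique isomorphism is then formal, and paths are dual.
\<close>

section \<open>Simplicial sets\<close>

lemma delta_category: "category delta"
proof (unfold_locales, goal_cases)
  case (3 X)
  then show ?case by (auto simp: delta_def hom_def mono_on_def)
next
  case (4 f X Y g Z)
  then show ?case by (auto simp: delta_def hom_def mono_on_def PiE_iff)
next
  case (5 f X Y)
  then show ?case
    by (cases f) (auto simp: delta_def hom_def PiE_iff extensional_def restrict_def fun_eq_iff)
next
  case (6 f X Y)
  then show ?case
    by (cases f) (auto simp: delta_def hom_def PiE_iff extensional_def restrict_def fun_eq_iff)
next
  case (7 f X Y g Z h W)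
  then show ?case
    by (auto simp: delta_def hom_def PiE_iff restrict_def fun_eq_iff)
qed (auto simp: delta_def)

interpretation delta: category delta
  by (rule delta_category)

text \<open>Actions are restricted to \<open>Ar delta\<close> and read their degrees off
  \<open>dsrc\<close> and \<open>dtrg\<close>; this form discharges such restrictions without
  unfolding \<open>delta\<close>.\<close>

lemma mem_hom_delta:
  "\<theta> \<in> hom delta m n \<longleftrightarrow> \<theta> \<in> Ar delta \<and> dsrc \<theta> = m \<and> dtrg \<theta> = n"
  by (auto simp: hom_def delta_def)

lemma sigma_in_hom: "sigma n \<in> hom delta n 0"
  by (auto simp: hom_def delta_def sigma_def mono_on_def)

text \<open>Values in \<open>{..0}\<close> are forced, and extensionality forces the rest. So
  \<Delta>[0] has the single simplex \<open>sigma n\<close> in degree n, which is what identifies K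
  x \<Delta>[0] with K.\<close>

lemma hom_delta_0: "\<theta> \<in> hom delta n 0 \<longleftrightarrow> \<theta> = sigma n"
proof
  show "\<theta> \<in> hom delta n 0 \<Longrightarrow> \<theta> = sigma n"
    by (cases \<theta>) (auto simp: hom_def delta_def sigma_def PiE_iff extensional_def restrict_def fun_eq_iff)
qed (simp add: sigma_in_hom)

lemma simplicial_set_std_simplex: "simplicial_set (std_simplex n)"
proof (unfold_locales, goal_cases)
  case (2 \<theta> m k)
  then show ?case
    by (auto simp: std_simplex_def mem_hom_delta[of \<theta>] intro: delta.comp_closed)
next
  case (3 x k)
  moreover have "Ident delta k \<in> hom delta k k"
    by (rule delta.id_closed) (simp add: delta_def)
  ultimately show ?case
    by (simp add: std_simplex_def mem_hom_delta[of "Ident delta k"] delta.id_right)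
next
  case (4 \<eta> l m \<theta> k x)
  then show ?case
    using delta.comp_closed[of \<eta> l m \<theta> k] delta.comp_closed[of \<theta> m k x n]
    by (auto simp: std_simplex_def mem_hom_delta[of \<eta>] mem_hom_delta[of \<theta>]
        mem_hom_delta[of "Comp delta \<theta> \<eta>"] delta.comp_assoc[of \<eta> l m \<theta> k x n])
qed (simp add: std_simplex_def)

section \<open>Products and maps of simplicial sets\<close>

lemma simplicial_set_sprod:
  assumes "simplicial_set A" and "simplicial_set B"
  shows "simplicial_set (sprod A B)"
proof -
  interpret A: simplicial_set A by fact
  interpret B: simplicial_set B by fact
  show ?thesis
  proof (unfold_locales, goal_cases)
    case (2 \<theta> m n)
    with A.act_closed[OF 2] B.act_closed[OF 2] show ?case
      by (auto simp: sprod_def mem_hom_delta[of \<theta>] PiE_iff)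
  next
    case (3 x n)
    moreover have "Ident delta n \<in> hom delta n n"
      by (rule delta.id_closed) (simp add: delta_def)
    ultimately show ?case
      by (auto simp: sprod_def mem_hom_delta[of "Ident delta n"] A.act_id B.act_id)
  next
    case (4 \<eta> l m \<theta> n x)
    with delta.comp_closed[of \<eta> l m \<theta> n] A.act_closed[of \<theta> m n] B.act_closed[of \<theta> m n]
    show ?case
      by (auto simp: sprod_def mem_hom_delta[of \<eta>] mem_hom_delta[of \<theta>]
          mem_hom_delta[of "Comp delta \<theta> \<eta>"] A.act_comp[of \<eta> l m \<theta> n]
          B.act_comp[of \<eta> l m \<theta> n] PiE_iff)
  qed (simp add: sprod_def)
qed

lemma smaps_app: "f \<in> smaps A B \<Longrightarrow> x \<in> simplices A n \<Longrightarrow> app f n x \<in> simplices B n"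
  by (auto simp: smaps_def PiE_iff)

lemma smaps_act:
  "f \<in> smaps A B \<Longrightarrow> \<theta> \<in> hom delta m n \<Longrightarrow> x \<in> simplices A n \<Longrightarrow>
    app f m (act A \<theta> x) = act B \<theta> (app f n x)"
  by (auto simp: smaps_def)

lemma smaps_src: "f \<in> smaps A B \<Longrightarrow> src f = A"
  and smaps_trg: "f \<in> smaps A B \<Longrightarrow> trg f = B"
  by (simp_all add: smaps_def)

lemma simplicial_set_act:
  "simplicial_set A \<Longrightarrow> \<theta> \<in> hom delta m n \<Longrightarrow> x \<in> simplices A n \<Longrightarrow> act A \<theta> x \<in> simplices A m"
  using simplicial_set.act_closed[of A \<theta> m n] by (auto simp: PiE_iff)

text \<open>Source and target are fixed by membership in \<open>smaps\<close>, and every component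
  is \<open>undefined\<close> off the simplices, so no other data can differ.\<close>

lemma smaps_eqI:
  assumes "f \<in> smaps A B" and "g \<in> smaps A B"
    and "\<And>n x. x \<in> simplices A n \<Longrightarrow> app f n x = app g n x"
  shows "f = g"
proof -
  have "app f n = app g n" for n
    using assms by (intro PiE_ext[of _ "simplices A n" "\<lambda>_. simplices B n"]) (auto simp: smaps_def)
  then have "app f = app g" by blast
  with assms(1,2) show ?thesis by (simp add: smaps_def)
qed

lemma smap_comp_app:
  "f \<in> smaps A B \<Longrightarrow> x \<in> simplices A n \<Longrightarrow> app (smap_comp g f) n x = app g n (app f n x)"
  by (simp add: smap_comp_def smaps_src)

lemma smapsI:
  assumes "src f = A" and "trg f = B" and "simplicial_set A" and "simplicial_set B"
    and "\<And>n. app f n \<in> extensional (simplices A n)"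
    and "\<And>n x. x \<in> simplices A n \<Longrightarrow> app f n x \<in> simplices B n"
    and "\<And>m n \<theta> x. \<theta> \<in> hom delta m n \<Longrightarrow> x \<in> simplices A n \<Longrightarrow>
      app f m (act A \<theta> x) = act B \<theta> (app f n x)"
  shows "f \<in> smaps A B"
  using assms by (simp add: smaps_def PiE_iff)

lemma smaps_simplicial_set:
  assumes "f \<in> smaps A B"
  shows "simplicial_set A" and "simplicial_set B"
  using assms by (simp_all add: smaps_def)

lemma smap_comp_closed:
  assumes f: "f \<in> smaps A B" and g: "g \<in> smaps B C"
  shows "smap_comp g f \<in> smaps A C"
proof (rule smapsI)
  show "app (smap_comp g f) n \<in> extensional (simplices A n)" for n
    by (simp add: smap_comp_def smaps_src[OF f])
  show "app (smap_comp g f) n x \<in> simplices C n" if "x \<in> simplices A n" for n x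
    unfolding smap_comp_app[OF f that] by (rule smaps_app[OF g smaps_app[OF f that]])
  show "app (smap_comp g f) m (act A \<theta> x) = act C \<theta> (app (smap_comp g f) n x)"
    if \<theta>: "\<theta> \<in> hom delta m n" and x: "x \<in> simplices A n" for m n \<theta> x
    using simplicial_set_act[OF smaps_simplicial_set(1)[OF f] \<theta> x]
    by (simp add: smap_comp_app[OF f] x smaps_act[OF f \<theta> x] smaps_act[OF g \<theta> smaps_app[OF f x]])
qed (simp_all add: smap_comp_def smaps_src[OF f] smaps_trg[OF g] smaps_simplicial_set(1)[OF f]
    smaps_simplicial_set(2)[OF g])

lemma smap_comp_assoc:
  assumes f: "f \<in> smaps A B" and g: "g \<in> smaps B C" and h: "h \<in> smaps C D"
  shows "smap_comp (smap_comp h g) f = smap_comp h (smap_comp g f)"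
proof (rule smaps_eqI)
  show "smap_comp (smap_comp h g) f \<in> smaps A D"
    by (intro smap_comp_closed[OF f] smap_comp_closed[OF g h])
  show "smap_comp h (smap_comp g f) \<in> smaps A D"
    by (intro smap_comp_closed[OF _ h] smap_comp_closed[OF f g])
  show "app (smap_comp (smap_comp h g) f) n x = app (smap_comp h (smap_comp g f)) n x"
    if x: "x \<in> simplices A n" for n x
    by (simp add: smap_comp_app[OF f x] smap_comp_app[OF g smaps_app[OF f x]]
        smap_comp_app[OF smap_comp_closed[OF f g] x])
qed

lemma smap_id_closed: "simplicial_set A \<Longrightarrow> smap_id A \<in> smaps A A"
  by (rule smapsI) (auto simp: smap_id_def dest: simplicial_set_act)

lemma smap_comp_id_left:
  assumes f: "f \<in> smaps A B"
  shows "smap_comp (smap_id B) f = f"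
proof (rule smaps_eqI)
  show "smap_comp (smap_id B) f \<in> smaps A B"
    by (intro smap_comp_closed[OF f] smap_id_closed smaps_simplicial_set(2)[OF f])
  show "app (smap_comp (smap_id B) f) n x = app f n x" if "x \<in> simplices A n" for n x
    unfolding smap_comp_app[OF f that] using smaps_app[OF f that] by (simp add: smap_id_def)
qed (rule f)

lemma pr1_closed:
  assumes "simplicial_set A" and "simplicial_set B"
  shows "pr1 A B \<in> smaps (sprod A B) A"
proof (rule smapsI)
  show "app (pr1 A B) m (act (sprod A B) \<theta> x) = act A \<theta> (app (pr1 A B) n x)"
    if \<theta>: "\<theta> \<in> hom delta m n" and x: "x \<in> simplices (sprod A B) n" for m n \<theta> x
  proof -
    have "fst (act (sprod A B) \<theta> x) = act A \<theta> (fst x)"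
      using that by (auto simp: sprod_def mem_hom_delta)
    then show ?thesis
      using x simplicial_set_act[OF simplicial_set_sprod[OF assms] \<theta> x] by (simp add: pr1_def)
  qed
  show "app (pr1 A B) n x \<in> simplices A n" if "x \<in> simplices (sprod A B) n" for n x
    using that by (auto simp: pr1_def sprod_def)
qed (use assms in \<open>simp_all add: pr1_def simplicial_set_sprod\<close>)

section \<open>Isomorphisms and vertices of the internal hom\<close>

lemma sisos_bij_betw:
  assumes "f \<in> sisos A B"
  shows "bij_betw (app f n) (simplices A n) (simplices B n)"
proof -
  from assms obtain g where f: "f \<in> smaps A B" and g: "g \<in> smaps B A"
    and gf: "smap_comp g f = smap_id A" and fg: "smap_comp f g = smap_id B"
    unfolding sisos_def by blast
  have "app g n (app f n x) = x" if "x \<in> simplices A n" for x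
    using smap_comp_app[OF f that, of g] that by (simp add: gf smap_id_def)
  moreover have "app f n (app g n y) = y" if "y \<in> simplices B n" for y
    using smap_comp_app[OF g that, of f] that by (simp add: fg smap_id_def)
  ultimately show ?thesis
    using smaps_app[OF f] smaps_app[OF g]
    by (intro bij_betw_byWitness[where f' = "app g n"]) auto
qed

lemma bij_betw_ex1:
  assumes "bij_betw f A B" and "y \<in> B"
  shows "\<exists>!x. x \<in> A \<and> f x = y"
  using assms by (auto simp: bij_betw_def dest: inj_onD)

text \<open>The action precomposes with \<open>std_map (sigma n)\<close>, which sends the identity
  of [n] to \<open>sigma n\<close>. As the pairs \<open>(a, sigma n)\<close> exhaust K x
  \<Delta>[0], evaluating the degeneracies of \<open>h\<close> recovers all of
  \<open>h\<close>.\<close>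

lemma ihom_act_sigma_app:
  assumes "h \<in> simplices (ihom K B) 0" and "a \<in> simplices K n"
  shows "app (act (ihom K B) (sigma n) h) n (a, Ident delta n) = app h n (a, sigma n)"
proof -
  have s: "sigma n \<in> Ar delta" "dtrg (sigma n) = 0" "dsrc (sigma n) = n"
    using sigma_in_hom[of n] by (auto simp: mem_hom_delta)
  have "Ident delta n \<in> hom delta n n"
    by (rule delta.id_closed) (simp add: delta_def)
  moreover have "Comp delta (sigma n) (Ident delta n) = sigma n"
    by (rule delta.id_right[OF sigma_in_hom])
  moreover have "act (ihom K B) (sigma n) h =
      smap_comp h (sprod_map (smap_id K) (std_map (sigma n)))"
    using assms(1) s by (simp add: ihom_def)
  ultimately show ?thesis
    using assms(2) s
    by (simp add: smap_comp_def sprod_map_def smap_id_def std_map_def sprod_def std_simplex_def)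
qed

text \<open>Stated through evaluation because that is the form in which the cylinder and path axioms constrain \<open>\<phi>\<close>.\<close>

lemma ihom_iso_unique_vertex:
  assumes \<phi>: "\<phi> \<in> sisos A (ihom K B)" and \<gamma>: "\<gamma> \<in> smaps K B"
  shows "\<exists>!s. s \<in> simplices A 0 \<and>
    (\<forall>n. \<forall>a\<in>simplices K n.
      app (ev K B) n (a, app \<phi> n (act A (sigma n) s)) = app \<gamma> n a)"
proof -
  let ?D = "std_simplex 0"
  have \<phi>m: "\<phi> \<in> smaps A (ihom K B)" using \<phi> by (simp add: sisos_def)
  have A: "simplicial_set A" using \<phi>m by (simp add: smaps_def)
  have K: "simplicial_set K" using \<gamma> by (simp add: smaps_def)
  \<comment> \<open>Naturality of \<phi> along \<open>sigma n\<close> moves the degeneracy from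
    \<open>s\<close> to \<open>app \<phi> 0 s\<close>.\<close>
  have ev: "app (ev K B) n (a, app \<phi> n (act A (sigma n) s)) = app (app \<phi> 0 s) n (a, sigma n)"
    if "s \<in> simplices A 0" and "a \<in> simplices K n" for s a n
  proof -
    have "app \<phi> n (act A (sigma n) s) \<in> simplices (ihom K B) n"
      using simplicial_set_act[OF A sigma_in_hom that(1)] by (rule smaps_app[OF \<phi>m])
    then show ?thesis
      using that ihom_act_sigma_app[OF smaps_app[OF \<phi>m that(1)] that(2)]
      by (simp add: ev_def smaps_act[OF \<phi>m sigma_in_hom])
  qed
  \<comment> \<open>The map \<gamma> seen as a vertex of \<open>ihom K B\<close>, through the
    projection from K x \<Delta>[0].\<close>
  define h where "h = smap_comp \<gamma> (pr1 K ?D)"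
  have p: "pr1 K ?D \<in> smaps (sprod K ?D) K"
    by (rule pr1_closed[OF K simplicial_set_std_simplex])
  have h: "h \<in> smaps (sprod K ?D) B"
    unfolding h_def by (rule smap_comp_closed[OF p \<gamma>])
  have prod: "x \<in> simplices (sprod K ?D) n \<longleftrightarrow> (\<exists>a\<in>simplices K n. x = (a, sigma n))" for x n
    by (auto simp: sprod_def std_simplex_def hom_delta_0)
  have h_app: "app h n (a, sigma n) = app \<gamma> n a" if "a \<in> simplices K n" for n a
    using that by (simp add: h_def smap_comp_app[OF p] prod) (simp add: pr1_def prod)
  \<comment> \<open>The evaluation conditions say precisely that \<open>app \<phi> 0 s\<close> and
    \<open>h\<close> agree on every simplex of K x \<Delta>[0]; bijectivity of \<phi> in degree 0
    then yields the unique \<open>s\<close>.\<close>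
  have "s \<in> simplices A 0 \<and>
      (\<forall>n. \<forall>a\<in>simplices K n. app (ev K B) n (a, app \<phi> n (act A (sigma n) s)) = app \<gamma> n a)
    \<longleftrightarrow> s \<in> simplices A 0 \<and> app \<phi> 0 s = h" for s
  proof (rule conj_cong[OF refl])
    assume s: "s \<in> simplices A 0"
    have \<phi>s: "app \<phi> 0 s \<in> smaps (sprod K ?D) B"
      using smaps_app[OF \<phi>m s] by (simp add: ihom_def)
    show "(\<forall>n. \<forall>a\<in>simplices K n. app (ev K B) n (a, app \<phi> n (act A (sigma n) s)) = app \<gamma> n a)
      \<longleftrightarrow> app \<phi> 0 s = h"
    proof
      show "app \<phi> 0 s = h"
        if "\<forall>n. \<forall>a\<in>simplices K n. app (ev K B) n (a, app \<phi> n (act A (sigma n) s)) = app \<gamma> n a"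
        using that by (intro smaps_eqI[OF \<phi>s h]) (auto simp: ev[OF s] h_app prod)
    qed (simp add: ev[OF s] h_app)
  qed
  moreover have "\<exists>!s. s \<in> simplices A 0 \<and> app \<phi> 0 s = h"
  proof -
    have "h \<in> simplices (ihom K B) 0" using h by (simp add: ihom_def)
    with sisos_bij_betw[OF \<phi>, of 0] show ?thesis
      by (rule bij_betw_ex1)
  qed
  ultimately show ?thesis by simp
qed

section \<open>Universal properties of cylinders and paths\<close>

context simplicial_category
begin

section \<open>Functoriality of the mapping spaces\<close>

text \<open>The first slot is contravariant: an arrow from X' to X is one from X to X' in
  \<open>op_cat S\<close>, whence the source pair (X, Y) and target pair (X', Y').\<close>

lemma shom_map_closed:
  assumes "f \<in> hom S X' X" and "g \<in> hom S Y Y'"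
  shows "shom_map S f g \<in> smaps (shom S X Y) (shom S X' Y')"
  using is_functor.ar_closed[OF shom_functor, of "(f, g)" "(X, Y)" "(X', Y')"] assms
  by (auto simp: hom_def prod_cat_def op_cat_def sSet_def)

lemma shom_map_id:
  assumes "X \<in> Ob S" and "Y \<in> Ob S"
  shows "shom_map S (Ident S X) (Ident S Y) = smap_id (shom S X Y)"
  using is_functor.pres_id[OF shom_functor, of "(X, Y)"] assms
  by (simp add: prod_cat_def op_cat_def sSet_def)

lemma shom_map_comp:
  assumes "f \<in> hom S X' X" and "f' \<in> hom S X'' X'" and "g \<in> hom S Y Y'" and "g' \<in> hom S Y' Y''"
  shows "shom_map S (Comp S f f') (Comp S g' g) = smap_comp (shom_map S f' g') (shom_map S f g)"
  using is_functor.pres_comp[OF shom_functor, of "(f, g)" "(X, Y)" "(X', Y')" "(f', g')" "(X'', Y'')"]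
    assms
  by (auto simp: hom_def prod_cat_def op_cat_def sSet_def)

text \<open>Functoriality with an identity in the other slot, composed with \<gamma> so that it
  rewrites the nested composites arising when two comparison arrows are chained.\<close>

lemma shom_map_comp_right:
  assumes X: "X \<in> Ob S" and g: "g \<in> hom S Y Y'" and g': "g' \<in> hom S Y' Y''"
    and \<gamma>: "\<gamma> \<in> smaps K (shom S X Y)"
  shows "smap_comp (shom_map S (Ident S X) (Comp S g' g)) \<gamma> =
    smap_comp (shom_map S (Ident S X) g') (smap_comp (shom_map S (Ident S X) g) \<gamma>)"
proof -
  have i: "Ident S X \<in> hom S X X" using X by (rule id_closed)
  show ?thesis
    using shom_map_comp[OF i i g g'] id_left[OF i]
    by (simp add: smap_comp_assoc[OF \<gamma> shom_map_closed[OF i g] shom_map_closed[OF i g']])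
qed

lemma shom_map_comp_left:
  assumes Z: "Z \<in> Ob S" and f: "f \<in> hom S X' X" and f': "f' \<in> hom S X'' X'"
    and \<gamma>: "\<gamma> \<in> smaps K (shom S X Z)"
  shows "smap_comp (shom_map S (Comp S f f') (Ident S Z)) \<gamma> =
    smap_comp (shom_map S f' (Ident S Z)) (smap_comp (shom_map S f (Ident S Z)) \<gamma>)"
proof -
  have i: "Ident S Z \<in> hom S Z Z" using Z by (rule id_closed)
  show ?thesis
    using shom_map_comp[OF f f' i i] id_left[OF i]
    by (simp add: smap_comp_assoc[OF \<gamma> shom_map_closed[OF f i] shom_map_closed[OF f' i]])
qed

text \<open>(S3) carries unique existence from vertices to arrows; leaving \<open>P\<close>
  arbitrary serves cylinders and paths alike.\<close>

lemma ex1_vertex: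
  assumes "X \<in> Ob S" and "Y \<in> Ob S"
    and "\<exists>!s. s \<in> simplices (shom S X Y) 0 \<and> P s"
  shows "\<exists>!f. f \<in> hom S X Y \<and> P (vertex S f)"
proof -
  note bij = vertex_bij[OF assms(1,2)]
  obtain s where s: "s \<in> simplices (shom S X Y) 0" "P s"
    and uniq: "\<And>t. t \<in> simplices (shom S X Y) 0 \<Longrightarrow> P t \<Longrightarrow> t = s"
    using assms(3) by blast
  have "f \<in> hom S X Y \<and> P (vertex S f) \<longleftrightarrow> f \<in> hom S X Y \<and> vertex S f = s" for f
    using s(2) uniq bij_betwE[OF bij] by blast
  with bij_betw_ex1[OF bij s(1)] show ?thesis by simp
qed

section \<open>Arrows out of cylinders and into paths\<close>

text \<open>\<open>ihom_iso_unique_vertex\<close> singles out a vertex by evaluation,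
  \<open>ex1_vertex\<close> turns it into an arrow, and compatibility with (S5) rewrites the
  evaluation condition as the stated equation.\<close>

lemma cylinder_universal:
  assumes X: "X \<in> Ob S" and cyl: "is_cylinder S K X XK \<alpha> \<phi>"
    and Y: "Y \<in> Ob S" and \<gamma>: "\<gamma> \<in> smaps K (shom S X Y)"
  shows "\<exists>!f. f \<in> hom S XK Y \<and> \<gamma> = smap_comp (shom_map S (Ident S X) f) \<alpha>"
proof -
  let ?A = "shom S XK Y" and ?B = "shom S X Y"
  have XK: "XK \<in> Ob S" and \<alpha>: "\<alpha> \<in> smaps K (shom S X XK)"
    and \<phi>: "\<phi> Y \<in> sisos ?A (ihom K ?B)"
    and comm: "smap_comp (ev K ?B) (sprod_map (smap_id K) (\<phi> Y)) =
      smap_comp (bullet S X XK Y) (sprod_map \<alpha> (smap_id ?A))"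
    using cyl Y by (auto simp: is_cylinder_def)
  have \<phi>m: "\<phi> Y \<in> smaps ?A (ihom K ?B)" using \<phi> by (simp add: sisos_def)
  have A: "simplicial_set ?A" using \<phi>m by (simp add: smaps_def)
  \<comment> \<open>The compatibility square read at the simplex (a, u).\<close>
  have ev: "app (ev K ?B) n (a, app (\<phi> Y) n u) = bul S X XK Y n u (app \<alpha> n a)"
    if "a \<in> simplices K n" and "u \<in> simplices ?A n" for n a u
    using arg_cong[OF comm, of "\<lambda>f. app f n (a, u)"] that
    by (simp add: smap_comp_def sprod_map_def smap_id_def sprod_def smaps_src[OF \<phi>m] smaps_src[OF \<alpha>])
  have "(\<forall>n. \<forall>a\<in>simplices K n.
      app (ev K ?B) n (a, app (\<phi> Y) n (act ?A (sigma n) (vertex S f))) = app \<gamma> n a)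
    \<longleftrightarrow> \<gamma> = smap_comp (shom_map S (Ident S X) f) \<alpha>" if f: "f \<in> hom S XK Y" for f
  proof -
    have v: "vertex S f \<in> simplices ?A 0"
      using vertex_bij[OF XK Y] f by (auto simp: bij_betw_def)
    \<comment> \<open>Take u to be the degenerate simplex on \<open>vertex S f\<close>: the
      resulting bullet is the right-hand side of (S5) for \<open>f\<close> acting on
      \<open>app \<alpha> n a\<close>.\<close>
    have "app (ev K ?B) n (a, app (\<phi> Y) n (act ?A (sigma n) (vertex S f))) =
        app (smap_comp (shom_map S (Ident S X) f) \<alpha>) n a" if a: "a \<in> simplices K n" for n a
      using ev[OF a simplicial_set_act[OF A sigma_in_hom v]]
        shom_map_right[OF X f smaps_app[OF \<alpha> a]]
      by (simp add: smap_comp_app[OF \<alpha> a])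
    moreover have "smap_comp (shom_map S (Ident S X) f) \<alpha> \<in> smaps K ?B"
      by (rule smap_comp_closed[OF \<alpha> shom_map_closed[OF id_closed[OF X] f]])
    ultimately show ?thesis
      using smaps_eqI[OF \<gamma>] by auto
  qed
  then show ?thesis
    \<comment> \<open>\<open>conj_cong\<close> supplies the membership of f in the hom set on which
      the equivalence depends.\<close>
    using ex1_vertex[OF XK Y ihom_iso_unique_vertex[OF \<phi> \<gamma>]] by (simp cong: conj_cong)
qed

text \<open>Dual to the cylinder case: f now acts by precomposition, so the contravariant half of
  (S5), \<open>shom_map_left\<close>, takes over.\<close>

lemma path_universal:
  assumes X: "X \<in> Ob S" and path: "is_path S K X XK \<beta> \<psi>"
    and Y: "Y \<in> Ob S" and \<gamma>: "\<gamma> \<in> smaps K (shom S Y X)"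
  shows "\<exists>!f. f \<in> hom S Y XK \<and> \<gamma> = smap_comp (shom_map S f (Ident S X)) \<beta>"
proof -
  let ?A = "shom S Y XK" and ?B = "shom S Y X"
  have XK: "XK \<in> Ob S" and \<beta>: "\<beta> \<in> smaps K (shom S XK X)"
    and \<psi>: "\<psi> Y \<in> sisos ?A (ihom K ?B)"
    and comm: "smap_comp (ev K ?B) (sprod_map (smap_id K) (\<psi> Y)) =
      smap_comp (bullet S Y XK X) (spair (pr2 K ?A) (smap_comp \<beta> (pr1 K ?A)))"
    using path Y by (auto simp: is_path_def)
  have \<psi>m: "\<psi> Y \<in> smaps ?A (ihom K ?B)" using \<psi> by (simp add: sisos_def)
  have A: "simplicial_set ?A" using \<psi>m by (simp add: smaps_def)
  \<comment> \<open>The pairing with \<open>pr2\<close> first sends (a, u) to (u, \<beta>(a)), so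
    \<beta>(a) is the outer factor of the bullet.\<close>
  have ev: "app (ev K ?B) n (a, app (\<psi> Y) n u) = bul S Y XK X n (app \<beta> n a) u"
    if "a \<in> simplices K n" and "u \<in> simplices ?A n" for n a u
    using arg_cong[OF comm, of "\<lambda>f. app f n (a, u)"] that
    by (simp add: smap_comp_def sprod_map_def spair_def pr1_def pr2_def smap_id_def sprod_def
        smaps_src[OF \<psi>m])
  have "(\<forall>n. \<forall>a\<in>simplices K n.
      app (ev K ?B) n (a, app (\<psi> Y) n (act ?A (sigma n) (vertex S f))) = app \<gamma> n a)
    \<longleftrightarrow> \<gamma> = smap_comp (shom_map S f (Ident S X)) \<beta>" if f: "f \<in> hom S Y XK" for f
  proof -
    have v: "vertex S f \<in> simplices ?A 0"
      using vertex_bij[OF Y XK] f by (auto simp: bij_betw_def)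
    have "app (ev K ?B) n (a, app (\<psi> Y) n (act ?A (sigma n) (vertex S f))) =
        app (smap_comp (shom_map S f (Ident S X)) \<beta>) n a" if a: "a \<in> simplices K n" for n a
      using ev[OF a simplicial_set_act[OF A sigma_in_hom v]]
        shom_map_left[OF X f smaps_app[OF \<beta> a]]
      by (simp add: smap_comp_app[OF \<beta> a])
    moreover have "smap_comp (shom_map S f (Ident S X)) \<beta> \<in> smaps K ?B"
      by (rule smap_comp_closed[OF \<beta> shom_map_closed[OF f id_closed[OF X]]])
    ultimately show ?thesis
      using smaps_eqI[OF \<gamma>] by auto
  qed
  then show ?thesis
    using ex1_vertex[OF Y XK ihom_iso_unique_vertex[OF \<psi> \<gamma>]] by (simp cong: conj_cong)
qed

section \<open>Uniqueness up to unique isomorphism\<close>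

text \<open>Both \<open>h\<close> and the identity solve the universal problem posed by \<alpha>
  itself.\<close>

lemma cylinder_endo_eq_id:
  assumes X: "X \<in> Ob S" and cyl: "is_cylinder S K X XK \<alpha> \<phi>"
    and h: "h \<in> hom S XK XK" and "\<alpha> = smap_comp (shom_map S (Ident S X) h) \<alpha>"
  shows "h = Ident S XK"
proof -
  have XK: "XK \<in> Ob S" and \<alpha>: "\<alpha> \<in> smaps K (shom S X XK)"
    using cyl by (auto simp: is_cylinder_def)
  have "\<alpha> = smap_comp (shom_map S (Ident S X) (Ident S XK)) \<alpha>"
    by (simp add: shom_map_id[OF X XK] smap_comp_id_left[OF \<alpha>])
  with assms(4) h id_closed[OF XK] cylinder_universal[OF X cyl XK \<alpha>] show ?thesis by blast
qed

lemma path_endo_eq_id: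
  assumes X: "X \<in> Ob S" and path: "is_path S K X XK \<beta> \<psi>"
    and h: "h \<in> hom S XK XK" and "\<beta> = smap_comp (shom_map S h (Ident S X)) \<beta>"
  shows "h = Ident S XK"
proof -
  have XK: "XK \<in> Ob S" and \<beta>: "\<beta> \<in> smaps K (shom S XK X)"
    using path by (auto simp: is_path_def)
  have "\<beta> = smap_comp (shom_map S (Ident S XK) (Ident S X)) \<beta>"
    by (simp add: shom_map_id[OF XK X] smap_comp_id_left[OF \<beta>])
  with assms(4) h id_closed[OF XK] path_universal[OF X path XK \<beta>] show ?thesis by blast
qed

lemma cylinder_unique:
  assumes X: "X \<in> Ob S" and c: "is_cylinder S K X XK \<alpha> \<phi>" and c': "is_cylinder S K X XK' \<alpha>' \<phi>'"
  shows "\<exists>!f. f \<in> isos S XK XK' \<and> \<alpha>' = smap_comp (shom_map S (Ident S X) f) \<alpha>"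
proof -
  have XK: "XK \<in> Ob S" "XK' \<in> Ob S"
    and \<alpha>: "\<alpha> \<in> smaps K (shom S X XK)" and \<alpha>': "\<alpha>' \<in> smaps K (shom S X XK')"
    using c c' by (auto simp: is_cylinder_def)
  note ex = cylinder_universal[OF X c XK(2) \<alpha>'] and ex' = cylinder_universal[OF X c' XK(1) \<alpha>]
  obtain f where f: "f \<in> hom S XK XK'" and f_eq: "\<alpha>' = smap_comp (shom_map S (Ident S X) f) \<alpha>"
    using ex by blast
  obtain g where g: "g \<in> hom S XK' XK" and g_eq: "\<alpha> = smap_comp (shom_map S (Ident S X) g) \<alpha>'"
    using ex' by blast
  \<comment> \<open>Read from right to left, \<open>f_eq\<close> and \<open>g_eq\<close> collapse
    the action of the composite on \<alpha> first to \<alpha>' and then back to \<alpha>.\<close>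
  have "Comp S g f = Ident S XK"
    by (intro cylinder_endo_eq_id[OF X c comp_closed[OF f g]])
      (simp add: shom_map_comp_right[OF X f g \<alpha>] flip: f_eq g_eq)
  moreover have "Comp S f g = Ident S XK'"
    by (intro cylinder_endo_eq_id[OF X c' comp_closed[OF g f]])
      (simp add: shom_map_comp_right[OF X g f \<alpha>'] flip: f_eq g_eq)
  ultimately have "f \<in> isos S XK XK'" using f g by (auto simp: isos_def)
  \<comment> \<open>Uniqueness among all arrows gives uniqueness among isomorphisms.\<close>
  with f_eq ex show ?thesis unfolding isos_def by blast
qed

lemma path_unique:
  assumes X: "X \<in> Ob S" and p: "is_path S K X XK \<beta> \<psi>" and p': "is_path S K X XK' \<beta>' \<psi>'"
  shows "\<exists>!f. f \<in> isos S XK XK' \<and> \<beta> = smap_comp (shom_map S f (Ident S X)) \<beta>'"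
proof -
  have XK: "XK \<in> Ob S" "XK' \<in> Ob S"
    and \<beta>: "\<beta> \<in> smaps K (shom S XK X)" and \<beta>': "\<beta>' \<in> smaps K (shom S XK' X)"
    using p p' by (auto simp: is_path_def)
  \<comment> \<open>Paths are terminal rather than initial, so f comes from the universal property
    of its target XK'.\<close>
  note ex = path_universal[OF X p' XK(1) \<beta>] and ex' = path_universal[OF X p XK(2) \<beta>']
  obtain f where f: "f \<in> hom S XK XK'" and f_eq: "\<beta> = smap_comp (shom_map S f (Ident S X)) \<beta>'"
    using ex by blast
  obtain g where g: "g \<in> hom S XK' XK" and g_eq: "\<beta>' = smap_comp (shom_map S g (Ident S X)) \<beta>"
    using ex' by blast
  have "Comp S g f = Ident S XK"
    by (intro path_endo_eq_id[OF X p comp_closed[OF f g]])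
      (simp add: shom_map_comp_left[OF X g f \<beta>] flip: f_eq g_eq)
  moreover have "Comp S f g = Ident S XK'"
    by (intro path_endo_eq_id[OF X p' comp_closed[OF g f]])
      (simp add: shom_map_comp_left[OF X f g \<beta>'] flip: f_eq g_eq)
  ultimately have "f \<in> isos S XK XK'" using f g by (auto simp: isos_def)
  with f_eq ex show ?thesis unfolding isos_def by blast
qed

end

theorem theorem1p2:
  fixes S :: "('o, 'm, 's) simp_cat" and X :: 'o and K :: "'k sset"
  assumes "simplicial_category S" and "X \<in> Ob S" and "simplicial_set K"
  shows "(\<forall>XK \<alpha> \<phi> XK' \<alpha>' \<phi>'.
            is_cylinder S K X XK \<alpha> \<phi> \<longrightarrow> is_cylinder S K X XK' \<alpha>' \<phi>' \<longrightarrow>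
              (\<exists>!f. f \<in> isos S XK XK' \<and> \<alpha>' = smap_comp (shom_map S (Ident S X) f) \<alpha>) \<and>
              isomorphic S XK XK')
       \<and> (\<forall>XK \<beta> \<psi> XK' \<beta>' \<psi>'.
            is_path S K X XK \<beta> \<psi> \<longrightarrow> is_path S K X XK' \<beta>' \<psi>' \<longrightarrow>
              (\<exists>!f. f \<in> isos S XK XK' \<and> \<beta> = smap_comp (shom_map S f (Ident S X)) \<beta>') \<and>
              isomorphic S XK XK')"
  \<comment> \<open>The existence half of each unique existence also shows that \<open>isos\<close>
    is nonempty.\<close>
  using simplicial_category.cylinder_unique[OF assms(1,2), of K]
    simplicial_category.path_unique[OF assms(1,2), of K]
  unfolding isomorphic_def by blast

end
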